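(* Let $(X_i)_{i\in\mathbb{N}}$ be a sequence of identically distributed real random variables on a probability space $(\Omega,\mathcal{F},\mathbb{P})$ with distribution function $F$, and let $\widehat F_n=\frac1n\sum_{i=1}^n \mathbf{1}_{[X_i,\infty)}$. Suppose that $(X_i)$ is $\alpha$-mixing with mixing coefficients $(\alpha(n))$. Let $r\in[0,\frac12)$ and assume that $\alpha(n)\le K n^{-\vartheta}$ for all $n\in\mathbb{N}$ and some constants $K>0$ and $\vartheta>2r$. Then $$n^{r}\,\|\widehat F_n-F\|_\infty\longrightarrow 0\qquad\mathbb{P}\text{-a.s. as } n\to\infty.$$
   Context: The mixing coefficients of a sequence $(X_i)_{i\in\mathbb{N}}$ are $\alpha(n):=\sup_{k\ge1}\sup_{A,B}|\mathbb{P}[A\cap B]-\mathbb{P}[A]\mathbb{P}[B]|$, where the second supremum ranges over all $A\in\sigma(X_1,\dots,X_k)$ and $B\in\sigma(X_{k+n},X_{k+n+1},\dots)$. The sequence is called $\alpha$-mixing if $\alpha(n)\to0$ as $n\to\infty$. Here $\|\psi\|_\infty=\sup_{x\in\mathbb{R}}|\psi(x)|$. *)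

theory Defs
  imports "HOL-Probability.Probability"
begin

text \<open>
  Sequences \<open>(X\<^sub>i)\<close> are indexed by the positive integers: they are functions on
  \<^typ>\<open>nat\<close> whose value at \<open>0\<close> is never used.
\<close>

definition generated_events :: "'a measure \<Rightarrow> (nat \<Rightarrow> 'a \<Rightarrow> real) \<Rightarrow> nat set \<Rightarrow> 'a set set" where
  "generated_events M X I =
     sigma_sets (space M) (\<Union>i\<in>I. {X i -` S \<inter> space M | S. S \<in> sets borel})"

text \<open>
  The suprema are taken in \<^typ>\<open>real\<close>; for random variables on a probability space they
  range over nonempty subsets of \<open>[0, 1]\<close>.
\<close>

definition mixing_coeff :: "'a measure \<Rightarrow> (nat \<Rightarrow> 'a \<Rightarrow> real) \<Rightarrow> nat \<Rightarrow> real" where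
  "mixing_coeff M X n =
     (SUP k\<in>{1..}. SUP (A, B)\<in>generated_events M X {1..k} \<times> generated_events M X {k + n..}.
        \<bar>measure M (A \<inter> B) - measure M A * measure M B\<bar>)"

definition alpha_mixing :: "'a measure \<Rightarrow> (nat \<Rightarrow> 'a \<Rightarrow> real) \<Rightarrow> bool" where
  "alpha_mixing M X \<longleftrightarrow> mixing_coeff M X \<longlonglongrightarrow> 0"

definition empirical_cdf :: "(nat \<Rightarrow> 'a \<Rightarrow> real) \<Rightarrow> nat \<Rightarrow> 'a \<Rightarrow> real \<Rightarrow> real" where
  "empirical_cdf X n \<omega> x = (1 / real n) * (\<Sum>i=1..n. indicator {X i \<omega>..} x)"

text \<open>Only meaningful for bounded \<open>\<psi>\<close>, because the supremum is taken in \<^typ>\<open>real\<close>.\<close>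

definition sup_norm :: "(real \<Rightarrow> real) \<Rightarrow> real" where
  "sup_norm \<psi> = (SUP x. \<bar>\<psi> x\<bar>)"

end

theory Submission
  imports Defs "HOL-Library.Log_Nat" "HOL-Real_Asymp.Real_Asymp"
begin

text \<open>
  Let \<open>S_n(y)\<close> be the sum of \<open>1[X_i \<le> y] - F(y)\<close> over \<open>1 \<le> i \<le> n\<close>, so that the claim says
  \<open>sup_y |S_n(y)| = o(n^(1-r))\<close> almost surely. Two supremum operations have to be controlled, over \<open>y\<close>
  and over \<open>n\<close>, and the exponent \<open>\<theta>\<close> may be so close to \<open>2r\<close> that no power of \<open>n\<close> can be given away.
  In particular a union bound over a grid of levels \<open>y\<close> is too expensive, and so is a polynomially
  sparse sequence of times \<open>n\<close>. Both suprema are instead handled by the Rademacher--Menshov chaining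
  device, which costs only logarithms.

  For \<open>n \<le> 2^N\<close> the line is cut into about \<open>2^N\<close> cells on which \<open>F\<close> varies by less than \<open>2^-N\<close>.
  With \<open>Y_ij\<close> the centred indicator of the event that \<open>X_i\<close> lies in cell \<open>j\<close>, the sum \<open>S_n(y)\<close> is, up to
  an error of at most 1, a rectangular partial sum of the array \<open>Y\<close>. Every initial segment of
  \<open>{..<2^N}\<close> is a disjoint union of at most one dyadic block per level, so Cauchy--Schwarz bounds the
  squares of all rectangular partial sums simultaneously by \<open>(N+1)(L+1)\<close> times the sum of the
  squares over all dyadic rectangles (\<open>rectangle_sum_square_le_energy\<close>).

  The expectation of that energy is where mixing enters. For fixed \<open>i\<close>, \<open>i'\<close> and a fixed level of
  cell blocks, one needs the sum over all blocks \<open>C\<close> of the covariances of \<open>1[X_i \<in> C]\<close> and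
  \<open>1[X_i' \<in> C]\<close>. Bounding each by \<open>\<alpha>\<close> would lose the number of blocks; but the covariance for every
  union of blocks is at most \<open>\<alpha>\<close>, and averaging over all unions isolates the diagonal, so that the
  whole sum is at most \<open>5\<alpha>(|i - i'|)\<close> (\<open>trace_le_of_square_sums\<close>). With some \<open>t \<in> (2r, 1)\<close>,
  \<open>t \<le> \<theta>\<close>, in place of \<open>\<theta>\<close>, the sum of \<open>\<alpha>(|i - i'|)\<close> over \<open>i' \<le> 2^N\<close> is at most of order \<open>2^(N(1-t))\<close>, and the
  expected energy is at most of order \<open>N^2 2^(N(2-t))\<close>. Even after multiplication by the chaining
  factor of order \<open>N^2\<close>, this becomes summable in \<open>N\<close> when divided by \<open>2^(2N(1-r))\<close>, because
  \<open>t > 2r\<close>. Hence the normalised energies tend to 0 almost surely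
  (\<open>AE_cell_counts_uniform\<close>); since the chaining
  bound is uniform over \<open>n \<le> 2^N\<close>, all \<open>n\<close> between consecutive powers of two are covered at once.

  \<open>F\<close> may have atoms. Cells are level sets of the rounded-down values of \<open>F(x)\<close> for upper bounds, and
  of the left limits \<open>F(x-)\<close> for lower bounds; the inequalities
  \<open>P(F(X) < u) \<le> u \<le> P(F(X-) < u)\<close> make these two families bracket \<open>{..y}\<close> with error \<open>2^-N\<close>
  whatever the atoms are.
\<close>

section \<open>Dyadic chaining for partial sums\<close>

definition dyadic_block :: "nat \<Rightarrow> nat \<Rightarrow> nat set" where
  "dyadic_block l b = {b * 2 ^ l ..< Suc b * 2 ^ l}"

lemma dyadic_block_0: "dyadic_block 0 b = {b}"
  by (auto simp: dyadic_block_def)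

lemma finite_dyadic_block: "finite (dyadic_block l b)"
  by (simp add: dyadic_block_def)

lemma card_dyadic_block: "card (dyadic_block l b) = 2 ^ l"
  by (simp add: dyadic_block_def)

lemma dyadic_block_subset: "b < 2 ^ (N - l) \<Longrightarrow> l \<le> N \<Longrightarrow> dyadic_block l b \<subseteq> {..<2 ^ N}"
proof -
  assume "b < 2 ^ (N - l)" "l \<le> N"
  then have "Suc b * 2 ^ l \<le> 2 ^ (N - l) * 2 ^ l"
    by (intro mult_right_mono) auto
  also have "\<dots> = 2 ^ N"
    using \<open>l \<le> N\<close> by (simp flip: power_add)
  finally show ?thesis
    by (auto simp: dyadic_block_def)
qed

lemma disjoint_dyadic_blocks: "b \<noteq> b' \<Longrightarrow> dyadic_block l b \<inter> dyadic_block l b' = {}"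
proof -
  have "i div 2 ^ l = b" if "i \<in> dyadic_block l b" for i b
    using that by (intro div_nat_eqI) (auto simp: dyadic_block_def mult.commute)
  then show "b \<noteq> b' \<Longrightarrow> ?thesis"
    by blast
qed

lemma sum_dyadic_block_Suc:
  fixes f :: "nat \<Rightarrow> real"
  shows "(\<Sum>i\<in>dyadic_block (Suc l) b. f i) = (\<Sum>i\<in>dyadic_block l b. f (2 * i) + f (Suc (2 * i)))"
proof -
  have pairs: "(\<Sum>i=2*m..<2*n. f i) = (\<Sum>i=m..<n. f (2 * i) + f (Suc (2 * i)))" if "m \<le> n" for m n
    using that by (induction n rule: dec_induct) (auto simp: algebra_simps)
  show ?thesis
    using pairs[of "b * 2 ^ l" "Suc b * 2 ^ l"] by (simp add: dyadic_block_def algebra_simps)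
qed

text \<open>
  Adding neighbouring terms in pairs halves the number of terms and shifts the levels by one. An
  initial segment of the original sequence is an initial segment of the paired one plus possibly a
  single unpaired term. That term is a block of level 0, and its absolute value is at most the Euclidean
  norm of all terms.
\<close>

lemma abs_partial_sum_le_dyadic:
  fixes f :: "nat \<Rightarrow> real"
  assumes "j \<le> 2 ^ N"
  shows "\<bar>\<Sum>i<j. f i\<bar> \<le> (\<Sum>l\<le>N. sqrt (\<Sum>b<2 ^ (N - l). (\<Sum>i\<in>dyadic_block l b. f i)^2))"
  using assms
proof (induction N arbitrary: f j)
  case 0
  then have "j = 0 \<or> j = 1" by auto
  then show ?case by (auto simp: dyadic_block_0)
next
  case (Suc N)
  define g where "g = (\<lambda>i. f (2 * i) + f (Suc (2 * i)))"
  define rest where "rest = (if odd j then f (j - 1) else 0)"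
  have split: "(\<Sum>i<j. f i) = (\<Sum>i<j div 2. g i) + rest"
  proof -
    have "(\<Sum>i<2*h. f i) = (\<Sum>i<h. g i)" for h
      by (induction h) (auto simp: g_def)
    then show ?thesis
      by (cases "even j") (auto elim!: evenE oddE simp: rest_def)
  qed
  have "rest^2 \<le> (\<Sum>b<2 ^ Suc N. (f b)^2)"
  proof (cases "odd j")
    case True
    then have "j - 1 < 2 ^ Suc N"
      using Suc.prems by (cases j) auto
    then show ?thesis
      using True by (auto simp: rest_def intro!: member_le_sum)
  qed (auto simp: rest_def intro: sum_nonneg)
  then have "\<bar>rest\<bar> \<le> sqrt (\<Sum>b<2 ^ Suc N. (f b)^2)"
    by (simp add: real_le_rsqrt)
  moreover have "\<bar>\<Sum>i<j div 2. g i\<bar> \<le> (\<Sum>l\<le>N. sqrt (\<Sum>b<2 ^ (N - l). (\<Sum>i\<in>dyadic_block l b. g i)^2))"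
    using Suc.prems by (intro Suc.IH) auto
  ultimately have "\<bar>\<Sum>i<j. f i\<bar> \<le> sqrt (\<Sum>b<2 ^ Suc N. (f b)^2)
      + (\<Sum>l\<le>N. sqrt (\<Sum>b<2 ^ (N - l). (\<Sum>i\<in>dyadic_block l b. g i)^2))"
    unfolding split by linarith
  also have "\<dots> = (\<Sum>l\<le>Suc N. sqrt (\<Sum>b<2 ^ (Suc N - l). (\<Sum>i\<in>dyadic_block l b. f i)^2))"
    by (simp add: sum.atMost_Suc_shift dyadic_block_0 sum_dyadic_block_Suc g_def del: sum.atMost_Suc)
  finally show ?case .
qed

lemma partial_sum_square_le_dyadic:
  fixes f :: "nat \<Rightarrow> real"
  assumes "j \<le> 2 ^ N"
  shows "(\<Sum>i<j. f i)^2 \<le> real (N + 1) * (\<Sum>l\<le>N. \<Sum>b<2 ^ (N - l). (\<Sum>i\<in>dyadic_block l b. f i)^2)"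
proof -
  let ?d = "\<lambda>l. sqrt (\<Sum>b<2 ^ (N - l). (\<Sum>i\<in>dyadic_block l b. f i)^2)"
  have "(\<Sum>i<j. f i)^2 \<le> (\<Sum>l\<le>N. ?d l)^2"
    using abs_partial_sum_le_dyadic[OF assms, of f] by (subst power2_abs [symmetric]) (rule power_mono, auto)
  also have "\<dots> \<le> (\<Sum>l\<le>N. (?d l)^2) * real (N + 1)"
    using sum_squared_le_sum_of_squares[of ?d "{..N}"] by simp
  finally show ?thesis
    by (simp add: sum_nonneg mult.commute)
qed

text \<open>
  The energy majorises all rectangular partial sums at once, yet is a finite sum of squares: it is
  measurable in the random case, and its expectation needs second moments only.
\<close>

definition dyadic_energy :: "nat \<Rightarrow> nat \<Rightarrow> (nat \<Rightarrow> nat \<Rightarrow> real) \<Rightarrow> real" where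
  "dyadic_energy N L y = (\<Sum>l\<le>N. \<Sum>b<2 ^ (N - l). \<Sum>l'\<le>L. \<Sum>b'<2 ^ (L - l').
     (\<Sum>i\<in>dyadic_block l b. \<Sum>j\<in>dyadic_block l' b'. y i j)^2)"

lemma dyadic_energy_nonneg: "dyadic_energy N L y \<ge> 0"
  by (auto simp: dyadic_energy_def intro!: sum_nonneg)

text \<open>
  Chaining in the first index, with the second index summed over an initial segment, followed by
  chaining in the second index inside every block.
\<close>

lemma rectangle_sum_square_le_energy:
  assumes "n \<le> 2 ^ N" and "k \<le> 2 ^ L"
  shows "(\<Sum>i<n. \<Sum>j<k. y i j)^2 \<le> real (N + 1) * real (L + 1) * dyadic_energy N L y"
proof -
  have "(\<Sum>i<n. \<Sum>j<k. y i j)^2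
      \<le> real (N + 1) * (\<Sum>l\<le>N. \<Sum>b<2 ^ (N - l). (\<Sum>i\<in>dyadic_block l b. \<Sum>j<k. y i j)^2)"
    by (rule partial_sum_square_le_dyadic[OF assms(1)])
  also have "\<dots> \<le> real (N + 1) * (\<Sum>l\<le>N. \<Sum>b<2 ^ (N - l). real (L + 1) *
      (\<Sum>l'\<le>L. \<Sum>b'<2 ^ (L - l'). (\<Sum>i\<in>dyadic_block l b. \<Sum>j\<in>dyadic_block l' b'. y i j)^2))"
  proof (intro mult_left_mono sum_mono)
    fix l b
    show "(\<Sum>i\<in>dyadic_block l b. \<Sum>j<k. y i j)^2 \<le> real (L + 1) *
      (\<Sum>l'\<le>L. \<Sum>b'<2 ^ (L - l'). (\<Sum>i\<in>dyadic_block l b. \<Sum>j\<in>dyadic_block l' b'. y i j)^2)"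
      using partial_sum_square_le_dyadic[OF assms(2), of "\<lambda>j. \<Sum>i\<in>dyadic_block l b. y i j"]
      by (simp add: sum.swap[of _ _ "dyadic_block l b"])
  qed simp
  finally show ?thesis
    by (simp add: dyadic_energy_def sum_distrib_left mult.assoc)
qed

section \<open>The trace of a matrix with bounded square sums\<close>

lemma sum_Pow_insert:
  fixes g :: "'b set \<Rightarrow> real"
  assumes "finite B" "x \<notin> B"
  shows "(\<Sum>S\<in>Pow (insert x B). g S) = (\<Sum>S\<in>Pow B. g S + g (insert x S))"
proof -
  have "inj_on (insert x) (Pow B)"
    using assms(2) by (auto simp: inj_on_def)
  then show ?thesis
    using assms unfolding Pow_insert sum.distrib
    by (subst sum.union_disjoint) (auto simp: sum.reindex)
qed

text \<open>
  Every element lies in exactly half of the subsets.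
\<close>

lemma sum_Pow_linear:
  fixes h :: "'b \<Rightarrow> real"
  assumes "finite B"
  shows "2 * (\<Sum>S\<in>Pow B. \<Sum>b\<in>S. h b) = 2 ^ card B * (\<Sum>b\<in>B. h b)"
  using assms
proof (induction B rule: finite_induct)
  case (insert x B)
  have "(\<Sum>S\<in>Pow B. \<Sum>b\<in>insert x S. h b) = (\<Sum>S\<in>Pow B. h x + (\<Sum>b\<in>S. h b))"
    using insert.hyps by (intro sum.cong refl sum.insert) (auto intro: finite_subset)
  then show ?case
    using insert by (simp add: sum_Pow_insert sum.distrib card_Pow algebra_simps)
qed simp

text \<open>
  A random subset contains a given element with probability 1/2 and two distinct given elements with
  probability 1/4, so the average of the sum over \<open>S \<times> S\<close> weighs the diagonal twice as much as the
  rest.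
\<close>

lemma sum_Pow_quadratic:
  fixes c :: "'b \<Rightarrow> 'b \<Rightarrow> real"
  assumes "finite B"
  shows "4 * (\<Sum>S\<in>Pow B. \<Sum>b\<in>S. \<Sum>b'\<in>S. c b b')
    = 2 ^ card B * ((\<Sum>b\<in>B. \<Sum>b'\<in>B. c b b') + (\<Sum>b\<in>B. c b b))"
  using assms
proof (induction B rule: finite_induct)
  case (insert x B)
  have fin: "finite S \<and> x \<notin> S" if "S \<in> Pow B" for S
    using that insert.hyps by (auto intro: finite_subset)
  have "(\<Sum>S\<in>Pow B. \<Sum>b\<in>insert x S. \<Sum>b'\<in>insert x S. c b b')
     = (\<Sum>S\<in>Pow B. c x x + (\<Sum>b\<in>S. c b x + c x b) + (\<Sum>b\<in>S. \<Sum>b'\<in>S. c b b'))"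
    using fin by (intro sum.cong refl) (simp add: sum.distrib)
  also have "\<dots> = 2 ^ card B * c x x + (\<Sum>S\<in>Pow B. \<Sum>b\<in>S. c b x + c x b)
      + (\<Sum>S\<in>Pow B. \<Sum>b\<in>S. \<Sum>b'\<in>S. c b b')"
    using insert.hyps by (simp add: sum.distrib card_Pow)
  finally show ?case
    using insert sum_Pow_linear[OF insert.hyps(1), of "\<lambda>b. c b x + c x b"]
    by (simp add: sum_Pow_insert sum.distrib algebra_simps)
qed simp

text \<open>
  By \<open>sum_Pow_quadratic\<close> the trace is four times an average of square sums, minus the sum over
  \<open>B \<times> B\<close>. The point is that the bound does not grow with the number of elements of \<open>B\<close>.
\<close>

lemma trace_le_of_square_sums:
  fixes c :: "'b \<Rightarrow> 'b \<Rightarrow> real"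
  assumes "finite B" and bound: "\<And>S. S \<subseteq> B \<Longrightarrow> \<bar>\<Sum>b\<in>S. \<Sum>b'\<in>S. c b b'\<bar> \<le> a"
  shows "(\<Sum>b\<in>B. c b b) \<le> 5 * a"
proof -
  have "4 * (\<Sum>S\<in>Pow B. \<Sum>b\<in>S. \<Sum>b'\<in>S. c b b') \<le> 4 * (\<Sum>S\<in>Pow B. a)"
    using bound by (intro mult_left_mono sum_mono) (auto simp: abs_le_iff)
  then have "2 ^ card B * ((\<Sum>b\<in>B. \<Sum>b'\<in>B. c b b') + (\<Sum>b\<in>B. c b b)) \<le> 2 ^ card B * (4 * a)"
    using assms(1) by (simp add: sum_Pow_quadratic card_Pow)
  then have "(\<Sum>b\<in>B. \<Sum>b'\<in>B. c b b') + (\<Sum>b\<in>B. c b b) \<le> 4 * a"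
    by simp
  then show ?thesis
    using bound[of B] by (simp add: abs_le_iff)
qed

section \<open>Expected energy of a random array\<close>

text \<open>
  For fixed rows \<open>i\<close>, \<open>i'\<close> the mixed moments of block sums form a matrix indexed by pairs of blocks.
  Its square sums are mixed moments over unions of blocks, hence covered by the hypothesis on
  arbitrary finite \<open>T\<close>, and the trace bound gives an estimate independent of the number \<open>m\<close> of blocks.
\<close>

lemma expectation_sum_block_squares_le:
  fixes Y :: "nat \<Rightarrow> nat \<Rightarrow> 'a \<Rightarrow> real"
  assumes int: "\<And>i j i' j'. integrable M (\<lambda>\<omega>. Y i j \<omega> * Y i' j' \<omega>)"
    and cov: "\<And>i i' T. finite T \<Longrightarrow> \<bar>\<integral>\<omega>. (\<Sum>j\<in>T. Y i j \<omega>) * (\<Sum>j\<in>T. Y i' j \<omega>) \<partial>M\<bar> \<le> a i i'"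
  shows "(\<Sum>b<m. \<integral>\<omega>. (\<Sum>i\<in>I. \<Sum>j\<in>dyadic_block l b. Y i j \<omega>)^2 \<partial>M) \<le> (\<Sum>i\<in>I. \<Sum>i'\<in>I. 5 * a i i')"
proof -
  define W where "W = (\<lambda>i b \<omega>. \<Sum>j\<in>dyadic_block l b. Y i j \<omega>)"
  have intW: "integrable M (\<lambda>\<omega>. W i b \<omega> * W i' b' \<omega>)" for i b i' b'
    unfolding W_def sum_product by (intro Bochner_Integration.integrable_sum int)
  have trace: "(\<Sum>b<m. \<integral>\<omega>. W i b \<omega> * W i' b \<omega> \<partial>M) \<le> 5 * a i i'" for i i'
  proof (rule trace_le_of_square_sums[where c = "\<lambda>b b'. \<integral>\<omega>. W i b \<omega> * W i' b' \<omega> \<partial>M"])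
    fix S :: "nat set" assume "S \<subseteq> {..<m}"
    then have S: "finite S" by (rule finite_subset) simp
    have W_S: "(\<Sum>b\<in>S. W i b \<omega>) = (\<Sum>j\<in>(\<Union>b\<in>S. dyadic_block l b). Y i j \<omega>)" for i \<omega>
      unfolding W_def using S disjoint_dyadic_blocks
      by (subst sum.UNION_disjoint) (auto simp: finite_dyadic_block)
    have "(\<Sum>b\<in>S. \<Sum>b'\<in>S. \<integral>\<omega>. W i b \<omega> * W i' b' \<omega> \<partial>M)
        = (\<integral>\<omega>. (\<Sum>b\<in>S. W i b \<omega>) * (\<Sum>b\<in>S. W i' b \<omega>) \<partial>M)"
      using intW by (simp add: sum_product)
    then show "\<bar>\<Sum>b\<in>S. \<Sum>b'\<in>S. \<integral>\<omega>. W i b \<omega> * W i' b' \<omega> \<partial>M\<bar> \<le> a i i'"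
      using S by (simp add: W_S cov finite_dyadic_block)
  qed simp
  have "(\<Sum>b<m. \<integral>\<omega>. (\<Sum>i\<in>I. W i b \<omega>)^2 \<partial>M) = (\<Sum>b<m. \<Sum>i\<in>I. \<Sum>i'\<in>I. \<integral>\<omega>. W i b \<omega> * W i' b \<omega> \<partial>M)"
    using intW by (simp add: power2_eq_square sum_product)
  also have "\<dots> = (\<Sum>i\<in>I. \<Sum>i'\<in>I. \<Sum>b<m. \<integral>\<omega>. W i b \<omega> * W i' b \<omega> \<partial>M)"
    by (subst sum.swap, rule sum.cong[OF refl], rule sum.swap)
  also have "\<dots> \<le> (\<Sum>i\<in>I. \<Sum>i'\<in>I. 5 * a i i')"
    by (intro sum_mono trace)
  finally show ?thesis
    by (simp add: W_def)
qed

text \<open>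
  On each of the \<open>N + 1\<close> row levels the blocks partition \<open>{..<2^N}\<close>, and each row of the matrix \<open>a\<close>
  contributes at most \<open>R\<close>; each of the \<open>L + 1\<close> column levels costs the same because the previous
  bound does not see the number of column blocks.
\<close>

lemma expectation_dyadic_energy_le:
  fixes Y :: "nat \<Rightarrow> nat \<Rightarrow> 'a \<Rightarrow> real"
  assumes int: "\<And>i j i' j'. integrable M (\<lambda>\<omega>. Y i j \<omega> * Y i' j' \<omega>)"
    and cov: "\<And>i i' T. finite T \<Longrightarrow> \<bar>\<integral>\<omega>. (\<Sum>j\<in>T. Y i j \<omega>) * (\<Sum>j\<in>T. Y i' j \<omega>) \<partial>M\<bar> \<le> a i i'"
    and row: "\<And>i. i < 2 ^ N \<Longrightarrow> (\<Sum>i'<2 ^ N. a i i') \<le> R"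
  shows "integrable M (\<lambda>\<omega>. dyadic_energy N L (\<lambda>i j. Y i j \<omega>))"
    and "(\<integral>\<omega>. dyadic_energy N L (\<lambda>i j. Y i j \<omega>) \<partial>M) \<le> 5 * real (N + 1) * real (L + 1) * 2 ^ N * R"
proof -
  have int_sq: "integrable M (\<lambda>\<omega>. (\<Sum>i\<in>I. \<Sum>j\<in>J. Y i j \<omega>)^2)" for I J
    unfolding power2_eq_square sum_product by (intro Bochner_Integration.integrable_sum int)
  show "integrable M (\<lambda>\<omega>. dyadic_energy N L (\<lambda>i j. Y i j \<omega>))"
    unfolding dyadic_energy_def by (intro Bochner_Integration.integrable_sum int_sq)
  have a_nonneg: "a i i' \<ge> 0" for i i'
    using cov[of "{}" i i'] by simp
  have block: "(\<Sum>i\<in>dyadic_block l b. \<Sum>i'\<in>dyadic_block l b. 5 * a i i') \<le> 5 * 2 ^ l * R"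
    if "l \<le> N" "b < 2 ^ (N - l)" for l b
  proof -
    have sub: "dyadic_block l b \<subseteq> {..<2 ^ N}"
      using that by (intro dyadic_block_subset)
    have "(\<Sum>i'\<in>dyadic_block l b. 5 * a i i') \<le> 5 * R" if "i \<in> dyadic_block l b" for i
    proof -
      have "(\<Sum>i'\<in>dyadic_block l b. a i i') \<le> (\<Sum>i'<2 ^ N. a i i')"
        using sub by (intro sum_mono2) (auto simp: a_nonneg)
      also have "\<dots> \<le> R"
        using sub that by (intro row) auto
      finally show ?thesis
        by (simp flip: sum_distrib_left)
    qed
    then have "(\<Sum>i\<in>dyadic_block l b. \<Sum>i'\<in>dyadic_block l b. 5 * a i i')
        \<le> (\<Sum>i\<in>dyadic_block l b. 5 * R)"
      by (intro sum_mono)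
    then show ?thesis
      by (simp add: card_dyadic_block)
  qed
  have "(\<integral>\<omega>. dyadic_energy N L (\<lambda>i j. Y i j \<omega>) \<partial>M)
      = (\<Sum>l\<le>N. \<Sum>b<2 ^ (N - l). \<Sum>l'\<le>L. \<Sum>b'<2 ^ (L - l').
           \<integral>\<omega>. (\<Sum>i\<in>dyadic_block l b. \<Sum>j\<in>dyadic_block l' b'. Y i j \<omega>)^2 \<partial>M)"
    unfolding dyadic_energy_def by (simp add: int_sq)
  also have "\<dots> \<le> (\<Sum>l\<le>N. \<Sum>b<(2::nat) ^ (N - l). \<Sum>l'\<le>L. 5 * 2 ^ l * R)"
    using block by (intro sum_mono order_trans[OF expectation_sum_block_squares_le[OF int cov]]) auto
  also have "\<dots> = (\<Sum>l\<le>N. 5 * real (L + 1) * R * (2 ^ (N - l) * 2 ^ l))"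
    by (simp add: algebra_simps)
  also have "\<dots> = (\<Sum>l\<le>N. 5 * real (L + 1) * R * 2 ^ N)"
    by (intro sum.cong refl) (simp flip: power_add)
  finally show "(\<integral>\<omega>. dyadic_energy N L (\<lambda>i j. Y i j \<omega>) \<partial>M) \<le> 5 * real (N + 1) * real (L + 1) * 2 ^ N * R"
    by (simp add: algebra_simps)
qed

section \<open>Covariances and mixing coefficients\<close>

lemma vimage_in_generated_events:
  assumes "i \<in> I" "S \<in> sets borel"
  shows "X i -` S \<inter> space M \<in> generated_events M X I"
  unfolding generated_events_def using assms by (intro sigma_sets.Basic) auto

context prob_space
begin

lemma covariance_le_mixing_coeff:
  assumes "k \<ge> 1" and "A \<in> generated_events M X {1..k}" and "B \<in> generated_events M X {k + n..}"
  shows "\<bar>prob (A \<inter> B) - prob A * prob B\<bar> \<le> mixing_coeff M X n"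
proof -
  let ?G = "\<lambda>k. generated_events M X {1..k} \<times> generated_events M X {k + n..}"
  let ?d = "\<lambda>(A, B). \<bar>prob (A \<inter> B) - prob A * prob B\<bar>"
  have le1: "?d p \<le> 1" for p
  proof (cases p)
    case (Pair A B)
    \<comment> \<open>Boundedness is what makes the real-valued suprema in the definition meaningful.\<close>
    have "prob A * prob B \<le> 1"
      using mult_mono[of "prob A" 1 "prob B" 1] by simp
    moreover have "0 \<le> prob A * prob B"
      by simp
    ultimately show ?thesis
      using prob_le_1[of "A \<inter> B"] measure_nonneg[of M "A \<inter> B"] unfolding Pair prod.case abs_le_iff by linarith
  qed
  have bdd: "bdd_above (?d ` ?G k)" for k
    using le1 by (intro bdd_aboveI2)
  have nonempty: "?G k \<noteq> {}" for k
    by (auto simp: generated_events_def intro: sigma_sets.Empty)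
  have "(SUP p\<in>?G k. ?d p) \<le> 1" for k
    using le1 nonempty by (intro cSUP_least)
  then have bdd': "bdd_above ((\<lambda>k. SUP p\<in>?G k. ?d p) ` {1..})"
    by (intro bdd_aboveI2)
  have "?d (A, B) \<le> (SUP p\<in>?G k. ?d p)"
    using assms by (intro cSUP_upper bdd) auto
  also have "\<dots> \<le> (SUP k\<in>{1..}. SUP p\<in>?G k. ?d p)"
    using assms by (intro cSUP_upper[OF _ bdd']) auto
  finally show ?thesis
    by (simp add: mixing_coeff_def)
qed

lemma covariance_indicator_le_mixing_coeff:
  assumes "1 \<le> i" "i < j" and S: "S \<in> sets borel"
  shows "\<bar>prob {\<omega> \<in> space M. X i \<omega> \<in> S \<and> X j \<omega> \<in> S}
      - prob {\<omega> \<in> space M. X i \<omega> \<in> S} * prob {\<omega> \<in> space M. X j \<omega> \<in> S}\<bar> \<le> mixing_coeff M X (j - i)"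
proof -
  have eq: "{\<omega> \<in> space M. X i \<omega> \<in> S} = X i -` S \<inter> space M"
    "{\<omega> \<in> space M. X j \<omega> \<in> S} = X j -` S \<inter> space M"
    "{\<omega> \<in> space M. X i \<omega> \<in> S \<and> X j \<omega> \<in> S} = (X i -` S \<inter> space M) \<inter> (X j -` S \<inter> space M)"
    by auto
  show ?thesis
    unfolding eq
    by (rule covariance_le_mixing_coeff[where k = i])
       (use assms in \<open>auto intro!: vimage_in_generated_events\<close>)
qed

text \<open>
  The expected value of the series is finite, so the series converges almost surely.
\<close>

lemma AE_tendsto_zero_of_summable_expectation:
  fixes Z :: "nat \<Rightarrow> 'a \<Rightarrow> real"
  assumes nonneg: "\<And>N \<omega>. Z N \<omega> \<ge> 0" and int: "\<And>N. integrable M (Z N)"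
    and summable: "summable (\<lambda>N. expectation (Z N))"
  shows "AE \<omega> in M. (\<lambda>N. Z N \<omega>) \<longlonglongrightarrow> 0"
proof -
  have [measurable]: "Z N \<in> borel_measurable M" for N
    using int by simp
  have "(\<integral>\<^sup>+\<omega>. (\<Sum>N. ennreal (Z N \<omega>)) \<partial>M) = (\<Sum>N. \<integral>\<^sup>+\<omega>. ennreal (Z N \<omega>) \<partial>M)"
    by (rule nn_integral_suminf) simp
  also have "\<dots> = (\<Sum>N. ennreal (expectation (Z N)))"
    using int nonneg by (simp add: nn_integral_eq_integral)
  also have "\<dots> = ennreal (\<Sum>N. expectation (Z N))"
    using summable nonneg by (intro suminf_ennreal2 Bochner_Integration.integral_nonneg)
  finally have "(\<integral>\<^sup>+\<omega>. (\<Sum>N. ennreal (Z N \<omega>)) \<partial>M) \<noteq> \<infinity>"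
    by simp
  then have "AE \<omega> in M. (\<Sum>N. ennreal (Z N \<omega>)) \<noteq> \<infinity>"
    by (intro nn_integral_PInf_AE) simp_all
  then show ?thesis
  proof eventually_elim
    case (elim \<omega>)
    then have "summable (\<lambda>N. Z N \<omega>)"
      using nonneg by (intro summable_suminf_not_top) auto
    then show ?case
      by (rule summable_LIMSEQ_zero)
  qed
qed

end

section \<open>Power sums\<close>

text \<open>
  By the mean value theorem the increment of \<open>x^(1-t) / (1-t)\<close> from \<open>n\<close> to \<open>n + 1\<close> is at least
  \<open>(n+1)^(-t)\<close>.
\<close>

lemma sum_powr_minus_le:
  fixes t :: real
  assumes "0 < t" "t < 1"
  shows "(\<Sum>k=1..n. real k powr (-t)) \<le> real n powr (1 - t) / (1 - t)"
proof (induction n)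
  case (Suc n)
  have "real (Suc n) powr (-t) * (1 - t) \<le> real (Suc n) powr (1 - t) - real n powr (1 - t)"
  proof (cases "n = 0")
    case False
    have "\<exists>z>real n. z < real (Suc n) \<and> real (Suc n) powr (1 - t) - real n powr (1 - t)
        = (real (Suc n) - real n) * ((1 - t) * z powr (1 - t - 1))"
      using False by (intro MVT2) (auto intro!: derivative_eq_intros)
    then obtain z where z: "real n < z" "z < real (Suc n)"
      and eq: "real (Suc n) powr (1 - t) - real n powr (1 - t) = (1 - t) * z powr (-t)"
      by auto
    have "real (Suc n) powr (-t) \<le> z powr (-t)"
      using z assms by (intro powr_mono2') auto
    then show ?thesis
      unfolding eq using assms by (simp add: mult.commute mult_left_mono)
  qed (use assms in auto)
  then have "real (Suc n) powr (-t) \<le> (real (Suc n) powr (1 - t) - real n powr (1 - t)) / (1 - t)"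
    using assms by (simp add: pos_le_divide_eq)
  with Suc.IH show ?case
    by (simp add: diff_divide_distrib)
qed simp

text \<open>
  The argument of \<open>a\<close> is the distance of \<open>i\<close> and \<open>i'\<close>, written with truncated subtraction. Every
  distance occurs at most once on either side of \<open>i\<close>.
\<close>

lemma sum_distance_le:
  fixes a :: "nat \<Rightarrow> real"
  assumes "\<And>k. a k \<ge> 0" "i < n"
  shows "(\<Sum>i'<n. a (i - i' + (i' - i))) \<le> 2 * (\<Sum>k<n. a k)"
proof -
  have "(\<Sum>i'<n. a (i - i' + (i' - i))) = (\<Sum>i'\<in>{..i}. a (i - i' + (i' - i))) + (\<Sum>i'\<in>{i<..<n}. a (i - i' + (i' - i)))"
    using assms(2) by (subst sum.union_disjoint [symmetric]) (auto intro!: sum.cong)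
  also have "(\<Sum>i'\<in>{..i}. a (i - i' + (i' - i))) = (\<Sum>k\<in>(\<lambda>i'. i - i') ` {..i}. a k)"
    by (subst sum.reindex) (auto simp: inj_on_def)
  also have "\<dots> \<le> (\<Sum>k<n. a k)"
    using assms by (intro sum_mono2) auto
  also have "(\<Sum>i'\<in>{i<..<n}. a (i - i' + (i' - i))) = (\<Sum>k\<in>(\<lambda>i'. i' - i) ` {i<..<n}. a k)"
    by (subst sum.reindex) (auto simp: inj_on_def)
  also have "\<dots> \<le> (\<Sum>k<n. a k)"
    using assms by (intro sum_mono2) auto
  finally show ?thesis
    by simp
qed

section \<open>The probability integral transform in the presence of atoms\<close>

text \<open>
  Apart from trivial cases, the down-set in question is a half-line bounded above. If it contains
  its supremum \<open>s\<close>, its probability is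
  \<open>cdf M s < u\<close>; otherwise it is the left limit of the distribution function at \<open>s\<close>.
\<close>

lemma (in real_distribution) prob_cdf_less_le:
  assumes "u \<ge> 0"
  shows "prob {y. cdf M y < u} \<le> u"
proof -
  let ?A = "{y. cdf M y < u}"
  have down: "x \<in> ?A" if "y \<in> ?A" "x \<le> y" for x y
    using that cdf_nondecreasing[of x y] by auto
  consider "?A = {}" | "u \<ge> 1" | "?A \<noteq> {}" "u < 1"
    by fastforce
  then show ?thesis
  proof cases
    case 3
    have "eventually (\<lambda>y. u < cdf M y) at_top"
      using cdf_lim_at_top_prob 3(2) by (rule order_tendstoD)
    then obtain m where m: "u < cdf M m"
      by (auto dest: eventually_happens)
    have "y \<le> m" if "y \<in> ?A" for y
    proof (rule ccontr)
      assume "\<not> y \<le> m"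
      then have "m \<in> ?A"
        using down[OF that] by simp
      with m show False
        by simp
    qed
    then have bdd: "bdd_above ?A"
      by (rule bdd_aboveI)
    define s where "s = Sup ?A"
    have below: "y \<in> ?A" if "y < s" for y
      using that 3(1) bdd down by (auto simp: s_def less_cSup_iff intro: less_imp_le)
    have above: "y \<le> s" if "y \<in> ?A" for y
      using that bdd unfolding s_def by (intro cSup_upper)
    show ?thesis
    proof (cases "s \<in> ?A")
      case True
      then have "prob ?A \<le> prob {..s}"
        using above by (intro finite_measure_mono) auto
      then show ?thesis
        using True by (simp add: cdf_def2)
    next
      case False
      have "prob {..<s} \<le> u"
      proof (rule tendsto_upperbound[OF cdf_at_left])
        show "\<forall>\<^sub>F y in at_left s. cdf M y \<le> u"
          using below by (auto simp: eventually_at_left_field intro!: exI[of _ "s - 1"] less_imp_le)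
      qed simp
      moreover have "prob ?A \<le> prob {..<s}"
        using above False by (intro finite_measure_mono) (force simp: less_le)+
      ultimately show ?thesis
        by simp
    qed
  qed (use assms prob_le_1 order_trans in auto)
qed

text \<open>
  Apart from trivial cases, the complement is an up-set with a finite infimum \<open>s\<close>. If \<open>s\<close>
  belongs to it, the set in question is \<open>{..<s}\<close>, whose probability is at least \<open>u\<close> by membership of \<open>s\<close>; otherwise it is
  \<open>{..s}\<close>, and right continuity of the distribution function yields the bound.
\<close>

lemma (in real_distribution) prob_left_cdf_less_ge:
  assumes "0 \<le> u" "u \<le> 1"
  shows "prob {y. prob {..<y} < u} \<ge> u"
proof -
  have mono: "prob {..<x} \<le> prob {..<y}" if "x \<le> y" for x y
    using that by (intro finite_measure_mono) auto
  have left_le: "prob {..<y} \<le> cdf M y" for y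
    unfolding cdf_def2 by (intro finite_measure_mono) auto
  let ?B = "{y. u \<le> prob {..<y}}"
  have compl: "prob {y. prob {..<y} < u} = 1 - prob ?B" if "?B \<in> sets borel"
    using prob_compl[of ?B] that by (simp add: Compl_eq_Diff_UNIV [symmetric] Collect_neg_eq [symmetric] not_le)
  have up: "y \<in> ?B" if "x \<in> ?B" "x \<le> y" for x y
    using that mono[of x y] by auto
  consider "?B = {}" | "u = 0" | "?B \<noteq> {}" "u > 0"
    using assms by fastforce
  then show ?thesis
  proof cases
    case 1
    then have "{y. prob {..<y} < u} = UNIV"
      by (auto simp: not_le)
    then show ?thesis
      using assms prob_space by simp
  next
    case 3
    have "eventually (\<lambda>y. cdf M y < u) at_bot"
      using cdf_lim_at_bot 3(2) by (rule order_tendstoD)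
    then obtain m where m: "cdf M m < u"
      by (auto dest: eventually_happens)
    have m': "prob {..<m} < u"
      using left_le[of m] m by (rule order.strict_trans1)
    have "m \<le> y" if "y \<in> ?B" for y
    proof (rule ccontr)
      assume "\<not> m \<le> y"
      then have "m \<in> ?B"
        using up[OF that] by simp
      with m' show False
        by simp
    qed
    then have bdd: "bdd_below ?B"
      by (rule bdd_belowI)
    define s where "s = Inf ?B"
    have above: "y \<in> ?B" if "s < y" for y
      using that 3(1) bdd up by (auto simp: s_def cInf_less_iff intro: less_imp_le)
    have below: "s \<le> y" if "y \<in> ?B" for y
      using that bdd unfolding s_def by (intro cInf_lower)
    show ?thesis
    proof (cases "s \<in> ?B")
      case True
      have "y \<in> ?B \<longleftrightarrow> s \<le> y" for y
        using below[of y] up[OF True, of y] by blast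
      then have "?B = {s..}"
        by blast
      moreover from this have "prob {y. prob {..<y} < u} = 1 - prob {s..}"
        by (subst compl) auto
      moreover have "prob {..<s} = 1 - prob {s..}"
        using prob_compl[of "{s..}"] by (simp add: Compl_eq_Diff_UNIV [symmetric])
      moreover have "u \<le> prob {..<s}"
        using True by simp
      ultimately show ?thesis
        by linarith
    next
      case False
      have "y \<in> ?B \<longleftrightarrow> s < y" for y
        using below[of y] above[of y] False by (metis order_le_less)
      then have "?B = {s<..}"
        by blast
      moreover from this have "prob {y. prob {..<y} < u} = 1 - prob {s<..}"
        by (subst compl) auto
      moreover have "prob {..s} = 1 - prob {s<..}"
        using prob_compl[of "{s<..}"] by (simp add: Compl_eq_Diff_UNIV [symmetric])
      moreover have "u \<le> cdf M s"
      proof (rule tendsto_lowerbound)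
        show "(cdf M \<longlongrightarrow> cdf M s) (at_right s)"
          using cdf_is_right_cont[of s] by (simp add: continuous_within)
        have "u \<le> cdf M y" if "s < y" for y
        proof -
          have "u \<le> prob {..<y}"
            using above[OF that] by blast
          then show ?thesis
            using left_le by (rule order_trans)
        qed
        then show "\<forall>\<^sub>F y in at_right s. u \<le> cdf M y"
          by (auto simp: eventually_at_right_field intro!: exI[of _ "s + 1"])
      qed simp
      ultimately show ?thesis
        by (simp add: cdf_def2)
    qed
  qed auto
qed

section \<open>Uniform control of cell counts\<close>

context prob_space
begin

definition cell_deviation :: "(nat \<Rightarrow> 'a \<Rightarrow> nat) \<Rightarrow> nat \<Rightarrow> nat \<Rightarrow> 'a \<Rightarrow> real" where
  "cell_deviation V i j \<omega> = of_bool (V i \<omega> = j) - prob {\<omega> \<in> space M. V i \<omega> = j}"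

text \<open>
  Sums of deviations over a set of cells are again centred indicators; this is why mixed moments over
  arbitrary sets of cells are covariances of two events.
\<close>

lemma sum_cell_deviation:
  assumes [measurable]: "V i \<in> measurable M (count_space UNIV)" and "finite T"
  shows "(\<Sum>j\<in>T. cell_deviation V i j \<omega>) = of_bool (V i \<omega> \<in> T) - prob {\<omega> \<in> space M. V i \<omega> \<in> T}"
proof -
  have "(\<Sum>j\<in>T. prob {\<omega> \<in> space M. V i \<omega> = j}) = prob (\<Union>j\<in>T. {\<omega> \<in> space M. V i \<omega> = j})"
    using assms(2)
    by (intro finite_measure_finite_Union [symmetric]) (auto simp: disjoint_family_on_def)
  also have "(\<Union>j\<in>T. {\<omega> \<in> space M. V i \<omega> = j}) = {\<omega> \<in> space M. V i \<omega> \<in> T}"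
    by auto
  finally have "(\<Sum>j\<in>T. prob {\<omega> \<in> space M. V i \<omega> = j}) = prob {\<omega> \<in> space M. V i \<omega> \<in> T}" .
  moreover have "(\<Sum>j\<in>T. of_bool (V i \<omega> = j) :: real) = of_bool (V i \<omega> \<in> T)"
    using assms(2) by (simp add: of_bool_def)
  ultimately show ?thesis
    by (simp add: cell_deviation_def sum_subtractf)
qed

lemma integrable_cell_deviation_mult:
  assumes [measurable]: "\<And>i. V i \<in> measurable M (count_space UNIV)"
  shows "integrable M (\<lambda>\<omega>. cell_deviation V i j \<omega> * cell_deviation V i' j' \<omega>)"
proof (rule integrable_const_bound[where B = 1])
  have "\<bar>cell_deviation V i j \<omega>\<bar> \<le> 1" for i j \<omega>
    using prob_le_1[of "{\<omega> \<in> space M. V i \<omega> = j}"] measure_nonneg[of M "{\<omega> \<in> space M. V i \<omega> = j}"]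
    unfolding cell_deviation_def by (auto simp: of_bool_def abs_le_iff simp del: measure_nonneg prob_le_1)
  then show "AE \<omega> in M. norm (cell_deviation V i j \<omega> * cell_deviation V i' j' \<omega>) \<le> 1"
    using mult_mono[of "\<bar>cell_deviation V i j \<omega>\<bar>" 1 "\<bar>cell_deviation V i' j' \<omega>\<bar>" 1 for \<omega>]
    by (intro AE_I2) (simp add: abs_mult)
qed (unfold cell_deviation_def, measurable)

lemma expectation_cell_deviation_mult:
  assumes meas [measurable]: "\<And>i. V i \<in> measurable M (count_space UNIV)" and "finite T"
  shows "expectation (\<lambda>\<omega>. (\<Sum>j\<in>T. cell_deviation V i j \<omega>) * (\<Sum>j\<in>T. cell_deviation V i' j \<omega>))
    = prob {\<omega> \<in> space M. V i \<omega> \<in> T \<and> V i' \<omega> \<in> T}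
      - prob {\<omega> \<in> space M. V i \<omega> \<in> T} * prob {\<omega> \<in> space M. V i' \<omega> \<in> T}"
proof -
  let ?E = "\<lambda>i. {\<omega> \<in> space M. V i \<omega> \<in> T}"
  have [measurable]: "?E i \<in> sets M" for i
    by measurable
  have "expectation (\<lambda>\<omega>. (\<Sum>j\<in>T. cell_deviation V i j \<omega>) * (\<Sum>j\<in>T. cell_deviation V i' j \<omega>))
      = expectation (\<lambda>\<omega>. indicator (?E i \<inter> ?E i') \<omega> - prob (?E i') * indicator (?E i) \<omega>
          - prob (?E i) * indicator (?E i') \<omega> + prob (?E i) * prob (?E i'))"
    by (intro Bochner_Integration.integral_cong refl)
       (auto simp: sum_cell_deviation[OF meas assms(2)] algebra_simps split: split_indicator)
  also have "\<dots> = prob (?E i \<inter> ?E i') - prob (?E i') * prob (?E i) - prob (?E i) * prob (?E i')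
      + prob (?E i) * prob (?E i')"
    by (simp add: prob_space emeasure_eq_measure)
  also have "?E i \<inter> ?E i' = {\<omega> \<in> space M. V i \<omega> \<in> T \<and> V i' \<omega> \<in> T}"
    by auto
  finally show ?thesis
    by (simp add: mult.commute)
qed

text \<open>
  Mixed moments of the centred cell indicators in rows \<open>i \<noteq> i'\<close> are covariances of events separated by
  a time lag \<open>|i - i'|\<close>, hence bounded by the mixing coefficient; on the diagonal the trivial bound 1
  is enough. Rows are numbered from 0 while \<open>X\<close> starts at index 1, whence the shift in \<open>V\<close>.
\<close>

lemma expectation_energy_le_of_mixing:
  fixes X :: "nat \<Rightarrow> 'a \<Rightarrow> real" and c :: "real \<Rightarrow> nat"
  assumes X: "\<And>i. i \<ge> 1 \<Longrightarrow> X i \<in> borel_measurable M"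
    and c [measurable]: "c \<in> measurable borel (count_space UNIV)"
    and "0 < t" "t < 1" "K > 0"
    and mix: "\<And>n. n \<ge> 1 \<Longrightarrow> mixing_coeff M X n \<le> K * real n powr (-t)"
  defines "V \<equiv> \<lambda>i \<omega>. c (X (Suc i) \<omega>)"
  shows "integrable M (\<lambda>\<omega>. dyadic_energy N L (\<lambda>i j. cell_deviation V i j \<omega>))"
    and "expectation (\<lambda>\<omega>. dyadic_energy N L (\<lambda>i j. cell_deviation V i j \<omega>))
      \<le> 10 * (1 + K / (1 - t)) * real (N + 1) * real (L + 1) * 2 ^ N * (2 ^ N) powr (1 - t)"
proof -
  have V [measurable]: "V i \<in> measurable M (count_space UNIV)" for i
    unfolding V_def using X[of "Suc i"] by (intro measurable_compose[OF _ c]) auto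
  define a where "a = (\<lambda>k::nat. if k = 0 then 1 else K * real k powr (-t))"
  have a_nonneg: "a k \<ge> 0" for k
    using \<open>K > 0\<close> by (simp add: a_def)
  have cov_less: "\<bar>prob {\<omega> \<in> space M. V i \<omega> \<in> T \<and> V i' \<omega> \<in> T}
      - prob {\<omega> \<in> space M. V i \<omega> \<in> T} * prob {\<omega> \<in> space M. V i' \<omega> \<in> T}\<bar> \<le> a (i' - i)"
    if "i < i'" for i i' T
  proof -
    have "c -` T \<in> sets borel"
      using measurable_sets[OF c, of T] by simp
    then have "\<bar>prob {\<omega> \<in> space M. V i \<omega> \<in> T \<and> V i' \<omega> \<in> T}
      - prob {\<omega> \<in> space M. V i \<omega> \<in> T} * prob {\<omega> \<in> space M. V i' \<omega> \<in> T}\<bar> \<le> mixing_coeff M X (i' - i)"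
      using covariance_indicator_le_mixing_coeff[of "Suc i" "Suc i'" "c -` T" X] that by (simp add: V_def)
    also have "\<dots> \<le> a (i' - i)"
      using mix[of "i' - i"] that by (simp add: a_def Suc_le_eq)
    finally show ?thesis .
  qed
  have cov: "\<bar>expectation (\<lambda>\<omega>. (\<Sum>j\<in>T. cell_deviation V i j \<omega>) * (\<Sum>j\<in>T. cell_deviation V i' j \<omega>))\<bar>
      \<le> a (i - i' + (i' - i))" if "finite T" for i i' T
  proof (cases i i' rule: linorder_cases)
    case less
    then show ?thesis
      using cov_less[of i i' T] by (simp add: expectation_cell_deviation_mult[OF V that])
  next
    case equal
    let ?p = "prob {\<omega> \<in> space M. V i \<omega> \<in> T}"
    have "?p * ?p \<le> 1 * ?p"
      by (intro mult_right_mono) auto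
    moreover have "0 \<le> ?p * ?p" "?p \<le> 1"
      by auto
    ultimately have "\<bar>?p - ?p * ?p\<bar> \<le> 1"
      by linarith
    then show ?thesis
      using equal by (simp add: expectation_cell_deviation_mult[OF V that] a_def)
  next
    case greater
    then show ?thesis
      using cov_less[of i' i T]
      by (simp add: expectation_cell_deviation_mult[OF V that] conj_commute mult.commute)
  qed
  have total: "(\<Sum>k<n. a k) \<le> (1 + K / (1 - t)) * real n powr (1 - t)" if "n \<ge> 1" for n
  proof -
    have "(\<Sum>k<n. a k) \<le> (\<Sum>k\<le>n. a k)"
      by (intro sum_mono2) (auto simp: a_nonneg)
    also have "\<dots> = 1 + K * (\<Sum>k=1..n. real k powr (-t))"
      by (simp add: atMost_atLeast0 sum.atLeast_Suc_atMost a_def sum_distrib_left)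
    also have "\<dots> \<le> real n powr (1 - t) + K * (real n powr (1 - t) / (1 - t))"
      using assms(3-5) that by (intro add_mono mult_left_mono sum_powr_minus_le ge_one_powr_ge_zero) auto
    finally show ?thesis
      by (simp add: algebra_simps)
  qed
  have row: "(\<Sum>i'<2 ^ N. a (i - i' + (i' - i))) \<le> 2 * ((1 + K / (1 - t)) * (2 ^ N) powr (1 - t))"
    if "i < 2 ^ N" for i
    using sum_distance_le[of a, OF a_nonneg that] total[of "2 ^ N"] by simp
  define C where "C = 1 + K / (1 - t)"
  note energy = expectation_dyadic_energy_le[of M "cell_deviation V" "\<lambda>i i'. a (i - i' + (i' - i))",
      OF integrable_cell_deviation_mult[OF V] cov row, folded C_def]
  show "integrable M (\<lambda>\<omega>. dyadic_energy N L (\<lambda>i j. cell_deviation V i j \<omega>))"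
    by (rule energy)
  have arrange: "5 * x * y * p * (2 * (C * w)) = 10 * C * x * y * p * w" for x y p w :: real
    by simp
  show "expectation (\<lambda>\<omega>. dyadic_energy N L (\<lambda>i j. cell_deviation V i j \<omega>))
      \<le> 10 * (1 + K / (1 - t)) * real (N + 1) * real (L + 1) * 2 ^ N * (2 ^ N) powr (1 - t)"
    unfolding C_def [symmetric] using energy(2)[of L] unfolding arrange .
qed

text \<open>
  \<open>Z N\<close> is the chaining bound for the squared deviations, normalised by the square of
  \<open>2^(N(1-r))\<close>. Its expectation is at most a polynomial in \<open>N\<close> times \<open>2^(-(t-2r)N)\<close>. The null set is
  chosen before \<open>N\<close>, \<open>n\<close> and \<open>k\<close>; with cell maps \<open>c N\<close> depending on \<open>N\<close>, the partition may become
  finer as the time horizon grows.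
\<close>

lemma AE_cell_counts_uniform:
  fixes X :: "nat \<Rightarrow> 'a \<Rightarrow> real" and c :: "nat \<Rightarrow> real \<Rightarrow> nat"
  assumes X: "\<And>i. i \<ge> 1 \<Longrightarrow> X i \<in> borel_measurable M"
    and c: "\<And>N. c N \<in> measurable borel (count_space UNIV)"
    and t: "2 * r < t" "0 < t" "t < 1" and "K > 0"
    and mix: "\<And>n. n \<ge> 1 \<Longrightarrow> mixing_coeff M X n \<le> K * real n powr (-t)"
  shows "AE \<omega> in M. \<exists>z. z \<longlonglongrightarrow> 0 \<and> (\<forall>N n k. n \<le> 2 ^ N \<longrightarrow> k \<le> 2 ^ Suc N \<longrightarrow>
    \<bar>\<Sum>i=1..n. of_bool (c N (X i \<omega>) < k) - prob {\<omega> \<in> space M. c N (X i \<omega>) < k}\<bar>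
      \<le> z N * 2 powr (real N * (1 - r)))"
proof -
  define V where "V = (\<lambda>N i \<omega>. c N (X (Suc i) \<omega>))"
  have V [measurable]: "V N i \<in> measurable M (count_space UNIV)" for N i
    unfolding V_def using X[of "Suc i"] by (intro measurable_compose[OF _ c]) auto
  define energy where "energy = (\<lambda>N \<omega>. dyadic_energy N (Suc N) (\<lambda>i j. cell_deviation (V N) i j \<omega>))"
  define Z where "Z = (\<lambda>N \<omega>. real (N + 1) * real (Suc N + 1) * energy N \<omega> / 2 powr (2 * (real N * (1 - r))))"
  define C where "C = 10 * (1 + K / (1 - t))"
  note energy_bounds = expectation_energy_le_of_mixing[OF X c t(2,3) \<open>K > 0\<close> mix, folded V_def]
  have energy_int: "integrable M (energy N)" for N
    unfolding energy_def V_def by (rule energy_bounds) auto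
  have energy_le: "expectation (energy N) \<le> C * real (N + 1) * real (Suc N + 1) * 2 ^ N * (2 ^ N) powr (1 - t)" for N
    unfolding energy_def V_def C_def by (rule energy_bounds) auto
  have Z_nonneg: "Z N \<omega> \<ge> 0" for N \<omega>
    by (simp add: Z_def energy_def dyadic_energy_nonneg)
  have Z_int: "integrable M (Z N)" for N
    unfolding Z_def using energy_int by simp
  have Z_le: "expectation (Z N) \<le> C * (real (N + 1) * real (N + 2))^2 * 2 powr (- (t - 2 * r) * real N)" for N
  proof -
    have "expectation (Z N) = real (N + 1) * real (N + 2) / 2 powr (2 * (real N * (1 - r))) * expectation (energy N)"
      by (simp add: Z_def add.commute)
    also have "\<dots> \<le> real (N + 1) * real (N + 2) / 2 powr (2 * (real N * (1 - r)))
        * (C * real (N + 1) * real (Suc N + 1) * 2 ^ N * (2 ^ N) powr (1 - t))"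
      by (intro mult_left_mono energy_le) auto
    also have "\<dots> = C * (real (N + 1) * real (N + 2))^2
        * (2 ^ N * (2 ^ N) powr (1 - t) / 2 powr (2 * (real N * (1 - r))))"
      by (simp add: power2_eq_square add.commute mult_ac)
    also have "2 ^ N * (2 ^ N) powr (1 - t) / 2 powr (2 * (real N * (1 - r))) = 2 powr (- (t - 2 * r) * real N)"
      by (simp add: powr_powr powr_add [symmetric] powr_diff [symmetric] algebra_simps flip: powr_realpow)
    finally show ?thesis .
  qed
  have "summable (\<lambda>N. expectation (Z N))"
  \<comment> \<open>Half of the geometric decay absorbs the polynomial factor.\<close>
  proof (rule summable_comparison_test_ev)
    define \<delta> where "\<delta> = t - 2 * r"
    have "\<delta> > 0"
      using t by (simp add: \<delta>_def)
    then have "eventually (\<lambda>N. C * (real (N + 1) * real (N + 2))^2 * 2 powr (- \<delta> * real N)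
        \<le> 2 powr (- (\<delta> / 2) * real N)) sequentially"
      by real_asymp
    then show "eventually (\<lambda>N. norm (expectation (Z N)) \<le> (2 powr (- (\<delta> / 2))) ^ N) sequentially"
    proof eventually_elim
      case (elim N)
      have "expectation (Z N) \<ge> 0"
        by (intro Bochner_Integration.integral_nonneg Z_nonneg)
      moreover have "2 powr (- (\<delta> / 2) * real N) = (2 powr (- (\<delta> / 2))) ^ N"
        by (simp add: powr_powr flip: powr_realpow)
      ultimately show ?case
        using elim Z_le[of N] by (simp add: \<delta>_def)
    qed
    have "2 powr (- (\<delta> / 2)) < 2 powr 0"
      using \<open>\<delta> > 0\<close> by (intro powr_less_mono) auto
    then show "summable (\<lambda>N. (2 powr (- (\<delta> / 2))) ^ N)"
      by (intro summable_geometric) simp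
  qed
  then have "AE \<omega> in M. (\<lambda>N. Z N \<omega>) \<longlonglongrightarrow> 0"
    by (intro AE_tendsto_zero_of_summable_expectation Z_nonneg Z_int)
  then show ?thesis
  proof eventually_elim
    case (elim \<omega>)
    have "\<bar>\<Sum>i=1..n. of_bool (c N (X i \<omega>) < k) - prob {\<omega> \<in> space M. c N (X i \<omega>) < k}\<bar>
      \<le> sqrt (Z N \<omega>) * 2 powr (real N * (1 - r))" if "n \<le> 2 ^ N" "k \<le> 2 ^ Suc N" for N n k
    proof -
      let ?S = "\<Sum>i=1..n. of_bool (c N (X i \<omega>) < k) - prob {\<omega> \<in> space M. c N (X i \<omega>) < k}"
      have "?S = (\<Sum>i<n. \<Sum>j<k. cell_deviation (V N) i j \<omega>)"
        by (simp add: sum_cell_deviation[OF V]) (simp add: V_def sum.atLeast1_atMost_eq)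
      then have "?S^2 \<le> real (N + 1) * real (Suc N + 1) * energy N \<omega>"
        using rectangle_sum_square_le_energy[OF that] by (simp add: energy_def)
      also have "\<dots> = Z N \<omega> * (2 powr (real N * (1 - r)))^2"
        by (simp add: Z_def powr_power mult.commute)
      finally have "sqrt (?S^2) \<le> sqrt (Z N \<omega> * (2 powr (real N * (1 - r)))^2)"
        by (rule real_sqrt_le_mono)
      then show ?thesis
        by (simp add: real_sqrt_mult)
    qed
    moreover have "(\<lambda>N. sqrt (Z N \<omega>)) \<longlonglongrightarrow> 0"
      using tendsto_real_sqrt[OF elim] by simp
    ultimately show ?case
      by (intro exI[of _ "\<lambda>N. sqrt (Z N \<omega>)"]) blast
  qed
qed

end

section \<open>Bracketing half-lines by cells\<close>

definition upper_cell :: "real measure \<Rightarrow> nat \<Rightarrow> real \<Rightarrow> nat" where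
  "upper_cell D N x = nat \<lfloor>2 ^ N * cdf D x\<rfloor>"

definition lower_cell :: "real measure \<Rightarrow> nat \<Rightarrow> real \<Rightarrow> nat" where
  "lower_cell D N x = nat \<lfloor>2 ^ N * measure D {..<x}\<rfloor>"

lemma nat_floor_less_iff: fixes z :: real
  shows "0 \<le> z \<Longrightarrow> nat \<lfloor>2 ^ N * z\<rfloor> < k \<longleftrightarrow> z < real k / 2 ^ N"
  by (simp add: nat_less_iff floor_less_iff pos_less_divide_eq mult.commute)

lemma nat_floor_le_power: fixes z :: real
  shows "z \<le> 1 \<Longrightarrow> nat \<lfloor>2 ^ N * z\<rfloor> \<le> 2 ^ N"
proof -
  assume "z \<le> 1"
  then have "2 ^ N * z \<le> (2 ^ N :: real)"
    by simp
  then have "\<lfloor>2 ^ N * z\<rfloor> \<le> \<lfloor>2 ^ N :: real\<rfloor>"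
    by (rule floor_mono)
  also have "\<lfloor>2 ^ N :: real\<rfloor> = int (2 ^ N)"
    by simp
  finally show ?thesis
    by (simp add: nat_le_iff)
qed

context real_distribution
begin

lemma measurable_upper_cell: "upper_cell M N \<in> measurable borel (count_space UNIV)"
proof -
  have [measurable]: "cdf M \<in> borel_measurable borel"
    by (intro borel_measurable_mono monoI cdf_nondecreasing)
  show ?thesis
    unfolding upper_cell_def by measurable
qed

lemma measurable_lower_cell: "lower_cell M N \<in> measurable borel (count_space UNIV)"
proof -
  have [measurable]: "(\<lambda>x. prob {..<x}) \<in> borel_measurable borel"
    by (intro borel_measurable_mono monoI finite_measure_mono) auto
  show ?thesis
    unfolding lower_cell_def by measurable
qed

text \<open>
  All points up to \<open>y\<close> lie in cells not above that of \<open>y\<close>, because the distribution function is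
  monotone; the integral transform bounds the probability of these cells by \<open>k / 2^N\<close>. As \<open>k\<close> can
  reach \<open>2^N + 1\<close>, the range of \<open>k\<close> extends to the next power of two.
\<close>

lemma upper_bracket:
  obtains k where "k \<le> 2 ^ Suc N" "\<And>x. x \<le> y \<Longrightarrow> upper_cell M N x < k"
    "prob {x. upper_cell M N x < k} \<le> cdf M y + 1 / 2 ^ N"
proof
  let ?k = "Suc (upper_cell M N y)"
  show "?k \<le> 2 ^ Suc N"
    using nat_floor_le_power[OF cdf_bounded_prob, of N y] one_le_power[of "2::nat" N]
    unfolding upper_cell_def power_Suc by linarith
  show "upper_cell M N x < ?k" if "x \<le> y" for x
    using cdf_nondecreasing[OF that]
    by (simp add: upper_cell_def less_Suc_eq_le nat_mono floor_mono)
  have "prob {x. upper_cell M N x < ?k} = prob {x. cdf M x < real ?k / 2 ^ N}"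
    by (simp only: upper_cell_def nat_floor_less_iff[OF cdf_nonneg])
  also have "\<dots> \<le> real ?k / 2 ^ N"
    by (intro prob_cdf_less_le) auto
  also have "real (upper_cell M N y) \<le> 2 ^ N * cdf M y"
    by (simp add: upper_cell_def cdf_nonneg)
  then have "real ?k / 2 ^ N \<le> cdf M y + 1 / 2 ^ N"
    by (simp add: field_simps)
  finally show "prob {x. upper_cell M N x < ?k} \<le> cdf M y + 1 / 2 ^ N" .
qed

text \<open>
  Points \<open>x > y\<close> satisfy \<open>cdf M y \<le> prob {..<x}\<close>, so their lower cell is at least the upper cell of
  \<open>y\<close>; left limits are essential here: a level set of the distribution function itself may begin with a
  heavy atom to the left of \<open>y\<close>, and discarding the cell of \<open>y\<close> would lose the mass of that atom.
\<close>

lemma lower_bracket: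
  obtains k where "k \<le> 2 ^ Suc N" "\<And>x. lower_cell M N x < k \<Longrightarrow> x \<le> y"
    "cdf M y - 1 / 2 ^ N \<le> prob {x. lower_cell M N x < k}"
proof
  let ?k = "upper_cell M N y"
  have le: "?k \<le> 2 ^ N"
    using nat_floor_le_power[OF cdf_bounded_prob, of N y] by (simp add: upper_cell_def)
  then show "?k \<le> 2 ^ Suc N"
    by simp
  show "x \<le> y" if "lower_cell M N x < ?k" for x
  proof (rule ccontr)
    assume "\<not> x \<le> y"
    then have "cdf M y \<le> prob {..<x}"
      unfolding cdf_def2 by (intro finite_measure_mono) auto
    then have "?k \<le> lower_cell M N x"
      by (simp add: upper_cell_def lower_cell_def nat_mono floor_mono)
    with that show False
      by simp
  qed
  have "cdf M y - 1 / 2 ^ N \<le> real ?k / 2 ^ N"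
  proof -
    have "2 ^ N * cdf M y \<le> real ?k + 1"
      unfolding upper_cell_def by linarith
    then have "(2 ^ N * cdf M y - 1) / 2 ^ N \<le> real ?k / 2 ^ N"
      by (intro divide_right_mono) auto
    then show ?thesis
      by (simp add: diff_divide_distrib)
  qed
  also have "\<dots> \<le> prob {x. prob {..<x} < real ?k / 2 ^ N}"
    using le by (intro prob_left_cdf_less_ge) (auto simp flip: of_nat_le_iff)
  also have "\<dots> = prob {x. lower_cell M N x < ?k}"
    by (simp only: lower_cell_def nat_floor_less_iff[OF measure_nonneg])
  finally show "cdf M y - 1 / 2 ^ N \<le> prob {x. lower_cell M N x < ?k}" .
qed

text \<open>
  Each of the \<open>n \<le> 2^N\<close> terms suffers a bracketing error of at most \<open>2^-N\<close>, which adds up to at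
  most 1.
\<close>

lemma empirical_sum_bound:
  fixes x :: "nat \<Rightarrow> real"
  assumes "n \<le> 2 ^ N"
    and upper: "\<And>k. k \<le> 2 ^ Suc N \<Longrightarrow>
      \<bar>\<Sum>i=1..n. of_bool (upper_cell M N (x i) < k) - prob {v. upper_cell M N v < k}\<bar> \<le> u"
    and lower: "\<And>k. k \<le> 2 ^ Suc N \<Longrightarrow>
      \<bar>\<Sum>i=1..n. of_bool (lower_cell M N (x i) < k) - prob {v. lower_cell M N v < k}\<bar> \<le> l"
  shows "\<bar>\<Sum>i=1..n. of_bool (x i \<le> y) - cdf M y\<bar> \<le> u + l + 1"
proof -
  have "real n \<le> 2 ^ N"
    using assms(1) by (metis of_nat_le_iff of_nat_numeral of_nat_power)
  then have err: "(\<Sum>i=1..n. 1 / 2 ^ N) \<le> (1 :: real)"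
    by simp
  have "0 \<le> u" "0 \<le> l"
    using upper[of 0] lower[of 0] by linarith+
  obtain k where k: "k \<le> 2 ^ Suc N" "\<And>x. x \<le> y \<Longrightarrow> upper_cell M N x < k"
    "prob {x. upper_cell M N x < k} \<le> cdf M y + 1 / 2 ^ N"
    by (rule upper_bracket[of N y]) (rule that)
  have "(\<Sum>i=1..n. of_bool (x i \<le> y) - cdf M y)
      \<le> (\<Sum>i=1..n. (of_bool (upper_cell M N (x i) < k) - prob {v. upper_cell M N v < k}) + 1 / 2 ^ N)"
  proof (rule sum_mono)
    fix i
    have "of_bool (x i \<le> y) \<le> (of_bool (upper_cell M N (x i) < k) :: real)"
      using k(2)[of "x i"] by simp
    then show "of_bool (x i \<le> y) - cdf M y
      \<le> (of_bool (upper_cell M N (x i) < k) - prob {v. upper_cell M N v < k}) + 1 / 2 ^ N"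
      using k(3) by linarith
  qed
  also have "\<dots> \<le> u + 1"
    using upper[OF k(1)] err unfolding sum.distrib by linarith
  finally have le: "(\<Sum>i=1..n. of_bool (x i \<le> y) - cdf M y) \<le> u + 1" .
  obtain k' where k': "k' \<le> 2 ^ Suc N" "\<And>x. lower_cell M N x < k' \<Longrightarrow> x \<le> y"
    "cdf M y - 1 / 2 ^ N \<le> prob {x. lower_cell M N x < k'}"
    by (rule lower_bracket[of N y]) (rule that)
  have "- l - 1
      \<le> (\<Sum>i=1..n. (of_bool (lower_cell M N (x i) < k') - prob {v. lower_cell M N v < k'}) - 1 / 2 ^ N)"
    using lower[OF k'(1)] err unfolding sum_subtractf[of _ "\<lambda>_. 1 / 2 ^ N"] by linarith
  also have "\<dots> \<le> (\<Sum>i=1..n. of_bool (x i \<le> y) - cdf M y)"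
  proof (rule sum_mono)
    fix i
    have "of_bool (lower_cell M N (x i) < k') \<le> (of_bool (x i \<le> y) :: real)"
      using k'(2)[of "x i"] by simp
    then show "(of_bool (lower_cell M N (x i) < k') - prob {v. lower_cell M N v < k'}) - 1 / 2 ^ N
      \<le> of_bool (x i \<le> y) - cdf M y"
      using k'(3) by linarith
  qed
  finally show ?thesis
    using le \<open>0 \<le> u\<close> \<open>0 \<le> l\<close> by (intro abs_leI) linarith+
qed

end

section \<open>Almost sure convergence of the empirical distribution function\<close>

text \<open>
  For \<open>n\<close> with \<open>2^(N-1) \<le> n < 2^N\<close>, which means \<open>N = floorlog 2 n\<close>, the factor \<open>n^(r-1)\<close> is at most
  \<open>2^(1-r) 2^(-N(1-r))\<close>, because \<open>r < 1\<close>. This cancels the normalisation of the bound, up to a constant.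
\<close>

lemma scaled_sup_norm_tendsto_zero:
  fixes X :: "nat \<Rightarrow> 'a \<Rightarrow> real" and F :: "real \<Rightarrow> real" and z :: "nat \<Rightarrow> real"
  assumes r: "r < 1" and z: "z \<longlonglongrightarrow> 0"
    and bound: "\<And>N n y. n \<le> 2 ^ N \<Longrightarrow>
      \<bar>\<Sum>i=1..n. of_bool (X i \<omega> \<le> y) - F y\<bar> \<le> z N * 2 powr (real N * (1 - r)) + 1"
  shows "(\<lambda>n. real n powr r * sup_norm (\<lambda>y. empirical_cdf X n \<omega> y - F y)) \<longlonglongrightarrow> 0"
proof -
  define b where "b = (\<lambda>N. 2 powr (1 - r) * (z N + 2 powr (- (real N * (1 - r)))))"
  have "((\<lambda>N. 2 powr (- (real N * (1 - r)))) \<longlonglongrightarrow> 0)"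
  proof -
    define \<delta> where "\<delta> = 1 - r"
    have "\<delta> > 0"
      using r by (simp add: \<delta>_def)
    then show ?thesis
      unfolding \<delta>_def [symmetric] by real_asymp
  qed
  then have "b \<longlonglongrightarrow> 2 powr (1 - r) * (0 + 0)"
    unfolding b_def using z by (intro tendsto_intros)
  then have b: "b \<longlonglongrightarrow> 0"
    by simp
  have scale: "filterlim (floorlog 2) sequentially sequentially"
    unfolding filterlim_at_top
  proof (intro allI eventually_sequentiallyI)
    fix Z n :: nat assume "2 ^ Z \<le> n"
    moreover have "0 < n"
      using calculation by (cases n) auto
    moreover have "n < 2 ^ floorlog 2 n"
      using floorlog_bounds[of n 2] calculation by simp
    ultimately have "2 ^ Z < (2::nat) ^ floorlog 2 n"
      by linarith
    then show "Z \<le> floorlog 2 n"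
      by simp
  qed
  have pointwise: "real n powr r * \<bar>empirical_cdf X n \<omega> y - F y\<bar> \<le> b (floorlog 2 n)" if "n \<ge> 1" for n y
  proof -
    define N where "N = floorlog 2 n"
    have N: "2 ^ (N - 1) \<le> n" "n < 2 ^ N"
      using floorlog_bounds[of n 2] that by (auto simp: N_def)
    then have "N \<ge> 1"
      using that by (cases N) auto
    have "empirical_cdf X n \<omega> y - F y = (\<Sum>i=1..n. of_bool (X i \<omega> \<le> y) - F y) / real n"
      using that by (simp add: empirical_cdf_def sum_subtractf indicator_def of_bool_def diff_divide_distrib)
    then have "real n powr r * \<bar>empirical_cdf X n \<omega> y - F y\<bar>
        = real n powr (r - 1) * \<bar>\<Sum>i=1..n. of_bool (X i \<omega> \<le> y) - F y\<bar>"
      using that by (simp add: powr_diff)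
    also have "\<dots> \<le> (2 powr (real N - 1)) powr (r - 1) * (z N * 2 powr (real N * (1 - r)) + 1)"
    proof (intro mult_mono bound powr_mono2')
      have "2 powr (real N - 1) = real (2 ^ (N - 1))"
        using \<open>N \<ge> 1\<close> by (simp add: of_nat_diff flip: powr_realpow)
      also have "\<dots> \<le> real n"
        using N(1) by (simp only: of_nat_le_iff)
      finally show "2 powr (real N - 1) \<le> real n" .
    qed (use r N in auto)
    also have "(2 powr (real N - 1)) powr (r - 1) = 2 powr (1 - r) * 2 powr (- (real N * (1 - r)))"
      unfolding powr_powr powr_add [symmetric] by (simp add: algebra_simps)
    also have "\<dots> * (z N * 2 powr (real N * (1 - r)) + 1) = b N"
      unfolding b_def powr_minus by (simp add: distrib_left)
    finally show ?thesis
      by (simp add: N_def)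
  qed
  show ?thesis
  proof (rule tendsto_sandwich[OF _ _ tendsto_const filterlim_compose[OF b scale]])
    show "\<forall>\<^sub>F n in sequentially. real n powr r * sup_norm (\<lambda>y. empirical_cdf X n \<omega> y - F y) \<le> b (floorlog 2 n)"
      using eventually_ge_at_top[of 1]
    proof eventually_elim
      case (elim n)
      have "\<bar>empirical_cdf X n \<omega> y - F y\<bar> \<le> b (floorlog 2 n) / real n powr r" for y
        using pointwise[OF elim, of y] elim by (simp add: pos_le_divide_eq mult.commute)
      then have "sup_norm (\<lambda>y. empirical_cdf X n \<omega> y - F y) \<le> b (floorlog 2 n) / real n powr r"
        unfolding sup_norm_def by (intro cSUP_least) auto
      then show ?case
        using elim by (simp add: pos_le_divide_eq mult.commute)
    qed
    show "\<forall>\<^sub>F n in sequentially. 0 \<le> real n powr r * sup_norm (\<lambda>y. empirical_cdf X n \<omega> y - F y)"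
      using eventually_ge_at_top[of 1]
    proof eventually_elim
      case (elim n)
      have "\<bar>empirical_cdf X n \<omega> y - F y\<bar> \<le> b (floorlog 2 n) / real n powr r" for y
        using pointwise[OF elim, of y] elim by (simp add: pos_le_divide_eq mult.commute)
      then have "bdd_above (range (\<lambda>y. \<bar>empirical_cdf X n \<omega> y - F y\<bar>))"
        by (intro bdd_aboveI2)
      then have "0 \<le> sup_norm (\<lambda>y. empirical_cdf X n \<omega> y - F y)"
        unfolding sup_norm_def by (intro cSUP_upper2[where x = 0]) auto
      then show ?case
        by simp
    qed
  qed
qed

theorem theorem2p2:
  fixes M :: "'a measure" and X :: "nat \<Rightarrow> 'a \<Rightarrow> real" and F :: "real \<Rightarrow> real"
    and r K \<theta> :: real
  assumes "prob_space M"
    and "\<And>i. i \<ge> 1 \<Longrightarrow> X i \<in> borel_measurable M"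
    and "\<And>i. i \<ge> 1 \<Longrightarrow> distr M borel (X i) = distr M borel (X 1)"
    and "F = cdf (distr M borel (X 1))"
    and "alpha_mixing M X"
    and "0 \<le> r" and "r < 1 / 2"
    and "K > 0" and "\<theta> > 2 * r"
    and "\<And>n. n \<ge> 1 \<Longrightarrow> mixing_coeff M X n \<le> K * real n powr (- \<theta>)"
  shows "AE \<omega> in M.
    (\<lambda>n. real n powr r * sup_norm (\<lambda>x. empirical_cdf X n \<omega> x - F x)) \<longlonglongrightarrow> 0"
proof -
  interpret prob_space M by fact
  define D where "D = distr M borel (X 1)"
  interpret D: real_distribution D
    unfolding D_def using assms(2)[of 1] by (intro real_distribution_distr) auto
  \<comment> \<open>The power sums need an exponent below 1, and r + 1/2 lies strictly between 2r and 1.\<close>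
  define t where "t = min \<theta> (r + 1 / 2)"
  have t: "2 * r < t" "0 < t" "t < 1"
    using assms(6-9) by (auto simp: t_def)
  have mix: "mixing_coeff M X n \<le> K * real n powr (-t)" if "n \<ge> 1" for n
  proof -
    have "real n powr (-\<theta>) \<le> real n powr (-t)"
      using that by (intro powr_mono) (auto simp: t_def)
    then have "K * real n powr (-\<theta>) \<le> K * real n powr (-t)"
      using \<open>K > 0\<close> by (intro mult_left_mono) auto
    then show ?thesis
      using assms(10)[OF that] by linarith
  qed
  have law: "(\<Sum>i=1..n. of_bool (c (X i \<omega>) < k) - prob {\<omega> \<in> space M. c (X i \<omega>) < k})
      = (\<Sum>i=1..n. of_bool (c (X i \<omega>) < k) - measure D {x. c x < k})"
    if c [measurable]: "c \<in> measurable borel (count_space UNIV)" for c :: "real \<Rightarrow> nat" and k n \<omega>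
  proof (rule sum.cong[OF refl])
    fix i assume "i \<in> {1..n}"
    then have i: "i \<ge> 1"
      by simp
    have [measurable]: "X i \<in> borel_measurable M"
      using assms(2)[OF i] .
    have "measure D {x. c x < k} = measure (distr M borel (X i)) {x. c x < k}"
      using assms(3)[OF i] by (simp add: D_def)
    also have "\<dots> = prob (X i -` {x. c x < k} \<inter> space M)"
      by (rule measure_distr) measurable
    also have "X i -` {x. c x < k} \<inter> space M = {\<omega> \<in> space M. c (X i \<omega>) < k}"
      by auto
    finally show "of_bool (c (X i \<omega>) < k) - prob {\<omega> \<in> space M. c (X i \<omega>) < k}
        = of_bool (c (X i \<omega>) < k) - measure D {x. c x < k}"
      by simp
  qed
  have "AE \<omega> in M. \<exists>z. z \<longlonglongrightarrow> 0 \<and> (\<forall>N n k. n \<le> 2 ^ N \<longrightarrow> k \<le> 2 ^ Suc N \<longrightarrow>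
      \<bar>\<Sum>i=1..n. of_bool (upper_cell D N (X i \<omega>) < k) - prob {\<omega> \<in> space M. upper_cell D N (X i \<omega>) < k}\<bar>
        \<le> z N * 2 powr (real N * (1 - r)))"
    by (rule AE_cell_counts_uniform[OF assms(2) D.measurable_upper_cell t \<open>K > 0\<close> mix])
  moreover have "AE \<omega> in M. \<exists>z. z \<longlonglongrightarrow> 0 \<and> (\<forall>N n k. n \<le> 2 ^ N \<longrightarrow> k \<le> 2 ^ Suc N \<longrightarrow>
      \<bar>\<Sum>i=1..n. of_bool (lower_cell D N (X i \<omega>) < k) - prob {\<omega> \<in> space M. lower_cell D N (X i \<omega>) < k}\<bar>
        \<le> z N * 2 powr (real N * (1 - r)))"
    by (rule AE_cell_counts_uniform[OF assms(2) D.measurable_lower_cell t \<open>K > 0\<close> mix])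
  ultimately show ?thesis
  proof eventually_elim
    case (elim \<omega>)
    obtain u where u: "u \<longlonglongrightarrow> 0" "\<And>N n k. n \<le> 2 ^ N \<Longrightarrow> k \<le> 2 ^ Suc N \<Longrightarrow>
      \<bar>\<Sum>i=1..n. of_bool (upper_cell D N (X i \<omega>) < k) - measure D {x. upper_cell D N x < k}\<bar>
        \<le> u N * 2 powr (real N * (1 - r))"
      using elim(1) unfolding law[OF D.measurable_upper_cell] by blast
    obtain l where l: "l \<longlonglongrightarrow> 0" "\<And>N n k. n \<le> 2 ^ N \<Longrightarrow> k \<le> 2 ^ Suc N \<Longrightarrow>
      \<bar>\<Sum>i=1..n. of_bool (lower_cell D N (X i \<omega>) < k) - measure D {x. lower_cell D N x < k}\<bar>
        \<le> l N * 2 powr (real N * (1 - r))"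
      using elim(2) unfolding law[OF D.measurable_lower_cell] by blast
    show ?case
    proof (rule scaled_sup_norm_tendsto_zero)
      show "r < 1"
        using \<open>r < 1 / 2\<close> by simp
      show "(\<lambda>N. u N + l N) \<longlonglongrightarrow> 0"
        using tendsto_add[OF u(1) l(1)] by simp
      fix N n y assume n: "n \<le> (2::nat) ^ N"
      have "\<bar>\<Sum>i=1..n. of_bool (X i \<omega> \<le> y) - cdf D y\<bar>
          \<le> u N * 2 powr (real N * (1 - r)) + l N * 2 powr (real N * (1 - r)) + 1"
        by (rule D.empirical_sum_bound[OF n u(2)[OF n] l(2)[OF n]])
      then show "\<bar>\<Sum>i=1..n. of_bool (X i \<omega> \<le> y) - F y\<bar> \<le> (u N + l N) * 2 powr (real N * (1 - r)) + 1"
        by (simp add: assms(4) D_def algebra_simps)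
    qed
  qed
qed

end
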